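(* Let $G$ be a connected graph and let $uv$ be a bridge of $G$ such that both components $H$ (containing $u$) and $H'$ (containing $v$) of $G-uv$ are non-trivial (have at least two vertices). Let $G'=\sigma(G,uv)$ be the graph obtained from $G$ by identifying the vertices $u$ and $v$ into a single vertex $u'$ and attaching a new pendent edge $u'v'$ at $u'$. Then $$ecc(G') < ecc(G).$$
   Context: For a connected graph $H$ on vertex set $V$ with $|V|=n$, $\varepsilon(v)=\max_{u\in V} d(u,v)$ ($d$ the shortest-path distance) and $ecc(H)=\frac{1}{n}\sum_{v\in V}\varepsilon(v)$. Note $G'$ has the same number of vertices as $G$. *)

theory Defs
  imports "Graph_Theory.Graph_Theory"
begin

text \<open>
  Finite simple undirected graphs are the \<^locale>\<open>pair_graph\<close>s of the library: an edge \<open>xy\<close> is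
  the pair of arcs \<open>(x, y)\<close>, \<open>(y, x)\<close>, and the components are the \<open>sccs\<close>, since the arc
  relation is symmetric.
\<close>

text \<open>
  \<open>\<mu>\<close> with unit weights is the least number of edges of a walk; on a connected graph it is finite.
\<close>

definition gdist :: "'a pair_pre_digraph \<Rightarrow> 'a \<Rightarrow> 'a \<Rightarrow> real" where
  "gdist G x y = real_of_ereal (wf_digraph.\<mu> (with_proj G) (\<lambda>_. 1) x y)"

definition eccentricity :: "'a pair_pre_digraph \<Rightarrow> 'a \<Rightarrow> real" where
  "eccentricity G x = Max ((\<lambda>y. gdist G y x) ` pverts G)"

definition ecc :: "'a pair_pre_digraph \<Rightarrow> real" where
  "ecc G = 1 / real (card (pverts G)) * (\<Sum>x\<in>pverts G. eccentricity G x)"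

definition del_edge :: "'a pair_pre_digraph \<Rightarrow> 'a \<Rightarrow> 'a \<Rightarrow> 'a pair_pre_digraph" where
  "del_edge G u v = \<lparr> pverts = pverts G, parcs = parcs G - {(u, v), (v, u)} \<rparr>"

definition components :: "'a pair_pre_digraph \<Rightarrow> ('a, 'a \<times> 'a) pre_digraph set" where
  "components G = pre_digraph.sccs (with_proj G)"

definition bridge :: "'a pair_pre_digraph \<Rightarrow> 'a \<Rightarrow> 'a \<Rightarrow> bool" where
  "bridge G u v \<longleftrightarrow> (u, v) \<in> parcs G \<and> card (components G) < card (components (del_edge G u v))"

text \<open>
  Identification of \<open>u\<close> and \<open>v\<close> into one vertex named \<open>u'\<close>; the loop arising from the edge \<open>uv\<close>
  is dropped. The name \<open>u'\<close> must not belong to a vertex of \<open>G\<close> other than \<open>u\<close> and \<open>v\<close>.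
\<close>

definition identify :: "'a pair_pre_digraph \<Rightarrow> 'a \<Rightarrow> 'a \<Rightarrow> 'a \<Rightarrow> 'a pair_pre_digraph" where
  "identify G u v u' = (let \<phi> = (\<lambda>x. if x = u \<or> x = v then u' else x) in
     \<lparr> pverts = \<phi> ` pverts G,
       parcs = {(\<phi> x, \<phi> y) | x y. (x, y) \<in> parcs G \<and> \<phi> x \<noteq> \<phi> y} \<rparr>)"

definition attach_pendent :: "'a pair_pre_digraph \<Rightarrow> 'a \<Rightarrow> 'a \<Rightarrow> 'a pair_pre_digraph" where
  "attach_pendent G x y =
     \<lparr> pverts = insert y (pverts G), parcs = parcs G \<union> {(x, y), (y, x)} \<rparr>"

definition sigma :: "'a pair_pre_digraph \<Rightarrow> 'a \<Rightarrow> 'a \<Rightarrow> 'a \<Rightarrow> 'a \<Rightarrow> 'a pair_pre_digraph" where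
  "sigma G u v u' v' = attach_pendent (identify G u v u') u' v'"

end

theory Submission
  imports Defs
begin

text \<open>
  Let \<open>A\<close>, \<open>B\<close> be the vertex sets of the two sides of the bridge \<open>uv\<close>, with \<open>u \<in> A\<close>, \<open>v \<in> B\<close>.
  Every walk from \<open>A\<close> to \<open>B\<close> crosses the bridge, so \<open>d(z, x) \<ge> d(z, u) + 1 + d(v, x)\<close> for
  \<open>z \<in> A\<close>, \<open>x \<in> B\<close>, while identifying \<open>u\<close> and \<open>v\<close> increases no distance. By symmetry assume that
  the eccentricity \<open>a\<close> of \<open>u\<close> within \<open>A\<close> is at least that of \<open>v\<close> within \<open>B\<close>. Compare the two graphs
  along the bijection \<open>u \<mapsto> u'\<close>, \<open>v \<mapsto> v'\<close> that fixes the remaining vertices. No eccentricity grows: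
  \<open>\<epsilon>'(u') \<le> a \<le> \<epsilon>(u)\<close> and \<open>\<epsilon>'(v') \<le> a + 1 \<le> \<epsilon>(v)\<close>. For \<open>x \<in> B - {v}\<close> it drops strictly,
  since \<open>\<epsilon>'(x) \<le> d(v, x) + a\<close> and \<open>\<epsilon>(x) \<ge> d(v, x) + 1 + a\<close>.
\<close>

section \<open>Distances and walks\<close>

context pair_wf_digraph
begin

text \<open>Lengths of walks become exponents of the arc relation, so that the later inductions run
  on a number and carry no arc lists.\<close>

lemma awalk_imp_relpow:
  "awalk x p y \<Longrightarrow> (x, y) \<in> parcs G ^^ length p"
  by (induction p arbitrary: x)
    (auto simp: awalk_Cons_iff awalk_Nil_iff simp del: relpow.simps(2) intro: relpow_Suc_I2)

lemma relpow_imp_awalk: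
  assumes "x \<in> pverts G" "(x, y) \<in> parcs G ^^ n"
  shows "\<exists>p. awalk x p y \<and> length p = n"
  using assms
proof (induction n arbitrary: x)
  case 0
  then show ?case by (auto simp: awalk_Nil_iff)
next
  case (Suc n)
  then obtain w where w: "(x, w) \<in> parcs G" "(w, y) \<in> parcs G ^^ n"
    by (meson relpow_Suc_E2)
  with Suc.IH in_arcsD2 obtain p where "awalk w p y" "length p = n" by blast
  with w show ?case
    by (intro exI[of _ "(x, w) # p"]) (auto simp: awalk_Cons_iff)
qed

lemma awalk_cost_unit: "awalk_cost (\<lambda>_. 1) p = real (length p)"
  by (induction p) auto

lemma reachable_iff_rtrancl:
  "x \<rightarrow>\<^sup>*\<^bsub>with_proj G\<^esub> y \<longleftrightarrow> x \<in> pverts G \<and> (x, y) \<in> (parcs G)\<^sup>*"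
proof
  assume "x \<rightarrow>\<^sup>*\<^bsub>with_proj G\<^esub> y"
  then show "x \<in> pverts G \<and> (x, y) \<in> (parcs G)\<^sup>*"
    using reachable_in_verts(1) reachable_rtranclI[of "with_proj G"] by auto
next
  assume *: "x \<in> pverts G \<and> (x, y) \<in> (parcs G)\<^sup>*"
  then obtain n where "(x, y) \<in> parcs G ^^ n" using rtrancl_power by blast
  with * relpow_imp_awalk show "x \<rightarrow>\<^sup>*\<^bsub>with_proj G\<^esub> y"
    by (meson reachable_awalk)
qed

text \<open>Reachability makes the least exponent exist. A walk of that length bounds
  \<open>\<mu>\<close> above, and every walk yields an exponent, which bounds it below. So
  \<open>\<mu>\<close> is finite and \<open>real_of_ereal\<close> returns its true value.\<close>

lemma gdist_attained:
  assumes "x \<in> pverts G" "(x, y) \<in> (parcs G)\<^sup>*"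
  obtains n where "gdist G x y = real n" "(x, y) \<in> parcs G ^^ n"
    "\<And>m. (x, y) \<in> parcs G ^^ m \<Longrightarrow> n \<le> m"
proof -
  define n where "n = (LEAST n. (x, y) \<in> parcs G ^^ n)"
  have n: "(x, y) \<in> parcs G ^^ n"
    using assms(2) unfolding n_def rtrancl_power by (auto intro: LeastI)
  have least: "n \<le> m" if "(x, y) \<in> parcs G ^^ m" for m
    unfolding n_def using that by (rule Least_le)
  have "\<mu> (\<lambda>_. 1) x y = ereal (real n)"
  proof (rule antisym)
    show "\<mu> (\<lambda>_. 1) x y \<le> ereal (real n)"
      using relpow_imp_awalk[OF assms(1) n] min_cost_le_walk_cost[of x _ y "\<lambda>_. 1"]
      by (auto simp: awalk_cost_unit)
    show "ereal (real n) \<le> \<mu> (\<lambda>_. 1) x y"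
      unfolding \<mu>_def by (rule INF_greatest) (auto simp: awalk_cost_unit dest: awalk_imp_relpow least)
  qed
  then have "gdist G x y = real n" by (simp add: gdist_def)
  with n least that show thesis by blast
qed

lemma gdist_le_relpow:
  assumes "x \<in> pverts G" "(x, y) \<in> parcs G ^^ n"
  shows "gdist G x y \<le> real n"
  using gdist_attained[OF assms(1) relpow_imp_rtrancl[OF assms(2)]] assms(2)
  by (metis of_nat_le_iff)

lemma gdist_refl: "x \<in> pverts G \<Longrightarrow> gdist G x x = 0"
  by (metis gdist_attained le_zero_eq of_nat_0 relpow_0_I rtrancl.rtrancl_refl)

lemma gdist_ge_1:
  assumes "x \<in> pverts G" "(x, y) \<in> (parcs G)\<^sup>*" "x \<noteq> y"
  shows "1 \<le> gdist G x y"
proof -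
  obtain n where n: "gdist G x y = real n" "(x, y) \<in> parcs G ^^ n"
    using gdist_attained[OF assms(1,2)] by metis
  with assms(3) have "n \<noteq> 0" by (metis relpow_0_E)
  with n show ?thesis by simp
qed

lemma gdist_arc: "(x, y) \<in> parcs G \<Longrightarrow> gdist G x y \<le> 1"
  using gdist_le_relpow[of x y 1] in_arcsD1 by simp

lemma gdist_triangle:
  assumes "x \<in> pverts G" "(x, y) \<in> (parcs G)\<^sup>*" "(y, z) \<in> (parcs G)\<^sup>*"
  shows "gdist G x z \<le> gdist G x y + gdist G y z"
proof (cases "x = y")
  case True
  with assms show ?thesis by (simp add: gdist_refl)
next
  case False
  with assms(1,2) have "y \<in> pverts G" by (metis in_arcsD2 rtranclE)
  with assms obtain m n where "gdist G x y = real m" "(x, y) \<in> parcs G ^^ m"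
    and "gdist G y z = real n" "(y, z) \<in> parcs G ^^ n"
    by (metis gdist_attained)
  moreover from this have "(x, z) \<in> parcs G ^^ (m + n)" by (auto simp: relpow_add)
  ultimately show ?thesis using gdist_le_relpow[OF assms(1)] by fastforce
qed

end

lemma (in pair_fin_digraph) gdist_le_eccentricity:
  "y \<in> pverts G \<Longrightarrow> gdist G y x \<le> eccentricity G x"
  unfolding eccentricity_def using pair_finite_verts by (intro Max_ge) auto

section \<open>Contracting a bridge\<close>

text \<open>The bridge is encoded as a vertex bipartition crossed by one edge, free of any mention
  of components. This form is preserved when the two sides are exchanged.\<close>

locale bridged_graph = pair_graph +
  fixes A B :: "'a set" and u v :: 'a
  assumes verts_eq: "pverts G = A \<union> B"
    and disjoint: "A \<inter> B = {}"
    and u_in_A: "u \<in> A" and v_in_B: "v \<in> B"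
    and bridge_arc: "(u, v) \<in> parcs G"
    and only_arc: "\<And>x y. (x, y) \<in> parcs G \<Longrightarrow> x \<in> A \<Longrightarrow> y \<in> B \<Longrightarrow> x = u \<and> y = v"
    and conn: "\<And>x y. x \<in> pverts G \<Longrightarrow> y \<in> pverts G \<Longrightarrow> (x, y) \<in> (parcs G)\<^sup>*"
begin

lemma arc_sym: "(x, y) \<in> parcs G \<Longrightarrow> (y, x) \<in> parcs G"
  using pair_sym_arcs by (auto simp: symmetric_def sym_def)

lemma swapped: "bridged_graph G B A v u"
  using verts_eq disjoint u_in_A v_in_B bridge_arc arc_sym only_arc conn
  by unfold_locales blast+

lemma u_neq_v: "u \<noteq> v"
  using disjoint u_in_A v_in_B by blast

text \<open>Follow the walk from its start. An arc inside \<open>A\<close> is absorbed by the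
  triangle inequality; the first arc into \<open>B\<close> is the bridge, which gives the 1.
  Arbitrary walks are allowed because the induction hypothesis is applied to tails.\<close>

lemma relpow_across:
  assumes "(x, z) \<in> parcs G ^^ n" "x \<in> A" "z \<in> B"
  shows "gdist G x u + 1 + gdist G v z \<le> real n"
  using assms
proof (induction n arbitrary: x)
  case 0
  with disjoint show ?case by auto
next
  case (Suc n)
  then obtain w where w: "(x, w) \<in> parcs G" "(w, z) \<in> parcs G ^^ n"
    by (meson relpow_Suc_E2)
  then have "w \<in> A \<union> B" using in_arcsD2 verts_eq by auto
  then show ?case
  proof
    assume "w \<in> A"
    with Suc w have "gdist G w u + 1 + gdist G v z \<le> real n" by blast
    moreover have "gdist G x u \<le> gdist G x w + gdist G w u"
      using Suc.prems \<open>w \<in> A\<close> u_in_A verts_eq by (intro gdist_triangle conn) auto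
    ultimately show ?thesis using gdist_arc[OF w(1)] by simp
  next
    assume "w \<in> B"
    with only_arc w Suc.prems have "x = u" "w = v" by auto
    with w u_in_A v_in_B verts_eq show ?thesis
      using gdist_le_relpow[of v z n] gdist_refl[of u] by auto
  qed
qed

lemma gdist_across:
  assumes "x \<in> A" "z \<in> B"
  shows "gdist G x u + 1 + gdist G v z \<le> gdist G x z"
proof -
  obtain n where "gdist G x z = real n" "(x, z) \<in> parcs G ^^ n"
    using gdist_attained[of x z] conn[of x z] assms verts_eq by (metis UnCI)
  with relpow_across assms show ?thesis by simp
qed

definition collapse :: "'a \<Rightarrow> 'a \<Rightarrow> 'a" where
  "collapse u' x = (if x = u \<or> x = v then u' else x)"

lemma pverts_sigma: "pverts (sigma G u v u' v') = insert v' (collapse u' ` pverts G)"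
  by (auto simp: sigma_def attach_pendent_def identify_def collapse_def Let_def)

lemma parcs_sigma: "parcs (sigma G u v u' v') =
  {(collapse u' x, collapse u' y) | x y. (x, y) \<in> parcs G \<and> collapse u' x \<noteq> collapse u' y}
    \<union> {(u', v'), (v', u')}"
  by (auto simp: sigma_def attach_pendent_def identify_def collapse_def Let_def)

lemma sigma_wf: "pair_wf_digraph (sigma G u v u' v')"
proof -
  have "u' \<in> collapse u' ` pverts G"
    using u_in_A verts_eq by (auto simp: collapse_def image_iff)
  then show ?thesis
    by unfold_locales (auto simp: pverts_sigma parcs_sigma dest: in_arcsD1 in_arcsD2)
qed

text \<open>The image of a walk is again a walk once the arcs whose ends are identified are dropped,
  so its length can only shrink.\<close>

lemma relpow_collapse:
  assumes "(x, y) \<in> parcs G ^^ n"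
  shows "\<exists>m\<le>n. (collapse u' x, collapse u' y) \<in> parcs (sigma G u v u' v') ^^ m"
  using assms
proof (induction n arbitrary: x)
  case 0
  then show ?case by auto
next
  case (Suc n)
  then obtain w where w: "(x, w) \<in> parcs G" "(w, y) \<in> parcs G ^^ n"
    by (meson relpow_Suc_E2)
  with Suc.IH obtain m where m: "m \<le> n"
    "(collapse u' w, collapse u' y) \<in> parcs (sigma G u v u' v') ^^ m" by blast
  show ?case
  proof (cases "collapse u' x = collapse u' w")
    case True
    with m show ?thesis by (intro exI[of _ m]) auto
  next
    case False
    with w have "(collapse u' x, collapse u' w) \<in> parcs (sigma G u v u' v')"
      by (auto simp: parcs_sigma)
    with m show ?thesis by (intro exI[of _ "Suc m"]) (auto simp del: relpow.simps intro: relpow_Suc_I2)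
  qed
qed

lemma gdist_collapse:
  assumes "x \<in> pverts G" "y \<in> pverts G"
  shows "gdist (sigma G u v u' v') (collapse u' x) (collapse u' y) \<le> gdist G x y"
    and "(collapse u' x, collapse u' y) \<in> (parcs (sigma G u v u' v'))\<^sup>*"
proof -
  interpret S: pair_wf_digraph "sigma G u v u' v'" by (rule sigma_wf)
  obtain n where n: "gdist G x y = real n" "(x, y) \<in> parcs G ^^ n"
    using gdist_attained[OF assms(1) conn[OF assms]] by metis
  obtain m where m: "m \<le> n"
    "(collapse u' x, collapse u' y) \<in> parcs (sigma G u v u' v') ^^ m"
    using relpow_collapse[OF n(2)] by blast
  then show "(collapse u' x, collapse u' y) \<in> (parcs (sigma G u v u' v'))\<^sup>*"
    by (auto dest: relpow_imp_rtrancl)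
  show "gdist (sigma G u v u' v') (collapse u' x) (collapse u' y) \<le> gdist G x y"
    using S.gdist_le_relpow[OF _ m(2)] m(1) n(1) assms by (force simp: pverts_sigma)
qed

lemma ecc_sigma_less_of_farthest:
  assumes a: "c \<in> A" "a = gdist G c u" "1 \<le> a"
    and maxA: "\<And>z. z \<in> A \<Longrightarrow> gdist G z u \<le> a"
    and maxB: "\<And>z. z \<in> B \<Longrightarrow> gdist G z v \<le> a"
    and w: "w \<in> B" "w \<noteq> v"
    and u': "u' \<notin> pverts G - {u, v}"
    and v': "v' \<notin> collapse u' ` pverts G"
  shows "ecc (sigma G u v u' v') < ecc G"
proof -
  define S where "S = sigma G u v u' v'"
  define f where "f = collapse u'"
  \<comment> \<open>\<open>f\<close> merges \<open>u\<close> and \<open>v\<close>; rerouting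
    \<open>v\<close> to the pendent vertex turns it into a bijection.\<close>
  define g where "g = (\<lambda>x. if x = v then v' else f x)"
  interpret S: pair_wf_digraph S unfolding S_def by (rule sigma_wf)
  interpret swap: bridged_graph G B A v u by (rule swapped)
  have fin: "finite (pverts G)" by (rule pair_finite_verts)
  have uV: "u \<in> pverts G" and vV: "v \<in> pverts G"
    using u_in_A v_in_B verts_eq by auto
  have f_uv: "f u = u'" "f v = u'" by (auto simp: f_def collapse_def)
  have fV: "f x \<in> pverts S" if "x \<in> pverts G" for x
    using that by (auto simp: S_def f_def pverts_sigma)
  have VS: "pverts S = insert v' (f ` pverts G)"
    by (auto simp: S_def f_def pverts_sigma)
  have v'V: "v' \<in> pverts S" by (simp add: VS)
  have contract: "gdist S (f x) (f y) \<le> gdist G x y"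
    and reach: "(f x, f y) \<in> (parcs S)\<^sup>*" if "x \<in> pverts G" "y \<in> pverts G" for x y
    using gdist_collapse[OF that] by (auto simp: S_def f_def)
  have pend: "(u', v') \<in> parcs S" "(v', u') \<in> parcs S"
    by (auto simp: S_def parcs_sigma)
  have tri: "gdist S (f x) (f y) \<le> gdist S (f x) u' + gdist S u' (f y)"
    if "x \<in> pverts G" "y \<in> pverts G" for x y
    using S.gdist_triangle[of "f x" "f u" "f y"] reach that uV fV f_uv by auto
  \<comment> \<open>Since \<open>f u = f v = u'\<close>, the cheaper of \<open>u\<close> and
    \<open>v\<close> may be used. Both directions are recorded, so no symmetry of
    \<open>gdist\<close> is invoked.\<close>
  have to_u': "gdist S (f y) u' \<le> gdist G y u" "gdist S (f y) u' \<le> gdist G y v"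
    and from_u': "gdist S u' (f y) \<le> gdist G u y" "gdist S u' (f y) \<le> gdist G v y"
    if "y \<in> pverts G" for y
    using contract[of y u] contract[of y v] contract[of u y] contract[of v y] that uV vV f_uv
    by auto
  have to_u'_le: "gdist S (f y) u' \<le> a" if "y \<in> pverts G" for y
    using to_u'[OF that] maxA[of y] maxB[of y] that verts_eq by fastforce
  have pend_from: "gdist S v' (f y) \<le> 1 + gdist S u' (f y)" if "y \<in> pverts G" for y
    using S.gdist_triangle[of v' u' "f y"] S.gdist_arc[OF pend(2)] reach[OF uV that]
      r_into_rtrancl[OF pend(2)] v'V f_uv by auto
  have pend_to: "gdist S (f y) v' \<le> gdist S (f y) u' + 1" if "y \<in> pverts G" for y
    using S.gdist_triangle[of "f y" u' v'] S.gdist_arc[OF pend(1)] reach[OF that uV]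
      r_into_rtrancl[OF pend(1)] fV[OF that] f_uv by auto
  have ecc_le: "eccentricity S x \<le> e"
    if "gdist S v' x \<le> e" "\<And>y. y \<in> pverts G \<Longrightarrow> gdist S (f y) x \<le> e" for x e
    unfolding eccentricity_def using that fin by (auto simp: VS)
  have ecc_B: "eccentricity S (f x) + 1 \<le> eccentricity G x" if x: "x \<in> B" for x
  proof -
    have xV: "x \<in> pverts G" using x verts_eq by simp
    have "a + 1 + gdist G v x \<le> gdist G c x"
      using gdist_across[OF a(1) x] a(2) by simp
    also have "\<dots> \<le> eccentricity G x"
      using a(1) verts_eq by (intro gdist_le_eccentricity) auto
    finally have low: "a + 1 + gdist G v x \<le> eccentricity G x" .
    have "eccentricity S (f x) \<le> a + gdist G v x"
    proof (rule ecc_le)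
      \<comment> \<open>The pendent edge costs 1, which \<open>1 \<le> a\<close> absorbs.\<close>
      show "gdist S v' (f x) \<le> a + gdist G v x"
        using pend_from[OF xV] from_u'(2)[OF xV] a(3) by simp
      show "gdist S (f y) (f x) \<le> a + gdist G v x" if "y \<in> pverts G" for y
        using tri[OF that xV] to_u'_le[OF that] from_u'(2)[OF xV] by simp
    qed
    with low show ?thesis by simp
  qed
  have ecc_u: "eccentricity S u' \<le> a"
  proof (rule ecc_le)
    show "gdist S v' u' \<le> a" using S.gdist_arc[OF pend(2)] a(3) by simp
  qed (rule to_u'_le)
  have g_le: "eccentricity S (g x) \<le> eccentricity G x" if xV: "x \<in> pverts G" for x
  proof -
    consider "x = v" | "x \<in> B" "x \<noteq> v" | "x = u" | "x \<in> A" "x \<noteq> u"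
      using xV verts_eq by auto
    then show ?thesis
    proof cases
      case 1
      have "eccentricity S v' \<le> a + 1"
      proof (rule ecc_le)
        show "gdist S v' v' \<le> a + 1" using S.gdist_refl[OF v'V] a(3) by simp
        show "gdist S (f y) v' \<le> a + 1" if "y \<in> pverts G" for y
          using pend_to[OF that] to_u'_le[OF that] by simp
      qed
      also have "\<dots> \<le> gdist G c v"
        using gdist_across[OF a(1) v_in_B] a(2) gdist_refl[OF vV] by simp
      also have "\<dots> \<le> eccentricity G v"
        using a(1) verts_eq by (intro gdist_le_eccentricity) auto
      finally show ?thesis using 1 by (simp add: g_def)
    next
      case 2
      with ecc_B[of x] show ?thesis by (simp add: g_def)
    next
      case 3
      have "a \<le> eccentricity G u"
        using gdist_le_eccentricity[of c u] a verts_eq by simp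
      with ecc_u 3 f_uv u_neq_v show ?thesis by (simp add: g_def)
    next
      case 4
      \<comment> \<open>For \<open>x\<close> in \<open>A\<close> the pendent vertex could be the new
        farthest one. It is no farther than \<open>v\<close> was in \<open>G\<close>, because
        \<open>v\<close> reaches \<open>x\<close> only over the bridge; all other distances shrink
        weakly by \<open>contract\<close>.\<close>
      have "1 + gdist G u x \<le> gdist G v x"
        using swap.gdist_across[OF v_in_B 4(1)] gdist_refl[OF vV] by simp
      then have "eccentricity S (f x) \<le> eccentricity G x"
        using pend_from[OF xV] from_u'(1)[OF xV] gdist_le_eccentricity[OF vV, of x]
          contract[OF _ xV] gdist_le_eccentricity[of _ x]
        by (intro ecc_le) fastforce+
      moreover have "x \<noteq> v" using 4 v_in_B disjoint by auto
      ultimately show ?thesis by (simp add: g_def)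
    qed
  qed
  have wV: "w \<in> pverts G" using w verts_eq by simp
  have bij: "bij_betw g (pverts G) (pverts S)"
  proof (rule bij_betw_imageI)
    have "f x = f y \<Longrightarrow> x = y" if "x \<in> pverts G - {v}" "y \<in> pverts G - {v}" for x y
      using u' that by (auto simp: f_def collapse_def split: if_splits)
    moreover have "f x \<noteq> v'" if "x \<in> pverts G" for x
      using v' that by (auto simp: f_def)
    ultimately show "inj_on g (pverts G)"
      unfolding inj_on_def g_def by (metis DiffI singletonD)
    \<comment> \<open>As \<open>g\<close> moves \<open>v\<close> away, \<open>u'\<close> is the only
      vertex that could be missed; \<open>u\<close> still maps to it.\<close>
    have "f v \<in> g ` pverts G"
      using uV f_uv u_neq_v by (auto simp: g_def image_iff intro!: bexI[of _ u])
    then show "g ` pverts G = pverts S"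
      using vV by (auto simp: VS g_def image_iff)
  qed
  have "(\<Sum>x\<in>pverts S. eccentricity S x) = (\<Sum>x\<in>pverts G. eccentricity S (g x))"
    using sum.reindex_bij_betw[OF bij] by metis
  also have "\<dots> < (\<Sum>x\<in>pverts G. eccentricity G x)"
  proof (rule sum_strict_mono_ex1[OF fin])
    \<comment> \<open>The strict term comes from \<open>w\<close>: off \<open>v\<close> the maps
      \<open>g\<close> and \<open>f\<close> agree, so \<open>ecc_B\<close> applies.\<close>
    show "\<exists>x\<in>pverts G. eccentricity S (g x) < eccentricity G x"
      using ecc_B[OF w(1)] w wV by (intro bexI[of _ w]) (auto simp: g_def)
  qed (use g_le in auto)
  moreover have "card (pverts S) = card (pverts G)"
    using bij_betw_same_card[OF bij] by simp
  moreover have "card (pverts G) > 0" using fin uV card_gt_0_iff by blast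
  ultimately show ?thesis
    unfolding S_def[symmetric] ecc_def by (simp add: divide_strict_right_mono)
qed

text \<open>The vertex \<open>c\<close> is one attaining the maximum over \<open>A\<close>. The
  second vertex \<open>z\<close> of \<open>A\<close> forces this maximum to be at least 1, while
  \<open>w\<close> supplies strictness.\<close>

lemma ecc_sigma_less_of_Max:
  assumes "z \<in> A" "z \<noteq> u" "w \<in> B" "w \<noteq> v"
    and "u' \<notin> pverts G - {u, v}" "v' \<notin> pverts (identify G u v u')"
    and le: "Max ((\<lambda>z. gdist G z v) ` B) \<le> Max ((\<lambda>z. gdist G z u) ` A)"
  shows "ecc (sigma G u v u' v') < ecc G"
proof -
  define a where "a = Max ((\<lambda>z. gdist G z u) ` A)"
  have fin: "finite A" "finite B" using pair_finite_verts verts_eq by auto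
  have "a \<in> (\<lambda>z. gdist G z u) ` A"
    unfolding a_def using fin u_in_A by (intro Max_in) auto
  then obtain c where c: "c \<in> A" "a = gdist G c u" by auto
  have maxA: "gdist G z u \<le> a" if "z \<in> A" for z
    unfolding a_def using fin that by auto
  have maxB: "gdist G z v \<le> a" if "z \<in> B" for z
    using le fin that unfolding a_def by (meson Max_ge finite_imageI imageI order_trans)
  have "1 \<le> gdist G z u"
    using assms u_in_A verts_eq by (intro gdist_ge_1 conn) auto
  with maxA[OF assms(1)] have "1 \<le> a" by simp
  moreover have "v' \<notin> collapse u' ` pverts G"
    using assms(6) by (auto simp: identify_def collapse_def Let_def)
  ultimately show ?thesis
    using ecc_sigma_less_of_farthest c maxA maxB assms by blast
qed

end

lemma sigma_commute: "sigma G u v u' v' = sigma G v u u' v'"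
  and identify_commute: "identify G u v u' = identify G v u u'"
  by (auto simp: sigma_def identify_def disj_commute)

text \<open>Hypotheses and construction are symmetric in the two sides, so the one with the larger
  maximum may play the role of \<open>A\<close>.\<close>

theorem (in bridged_graph) ecc_sigma_less:
  assumes "z \<in> A" "z \<noteq> u" "w \<in> B" "w \<noteq> v"
    and "u' \<notin> pverts G - {u, v}" "v' \<notin> pverts (identify G u v u')"
  shows "ecc (sigma G u v u' v') < ecc G"
proof (cases "Max ((\<lambda>z. gdist G z v) ` B) \<le> Max ((\<lambda>z. gdist G z u) ` A)")
  case True
  with assms show ?thesis by (rule ecc_sigma_less_of_Max)
next
  case False
  then show ?thesis
    using bridged_graph.ecc_sigma_less_of_Max[OF swapped assms(3,4,1,2), of u' v'] assms(5,6)
    by (simp add: sigma_commute[of G u] identify_commute[of G u] insert_commute)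
qed

section \<open>Components of a graph without its bridge\<close>

lemma (in pair_graph) pair_graph_del_edge: "pair_graph (del_edge G x y)"
  using pair_sym_arcs pair_finite_verts pair_finite_arcs pair_no_loops
  by unfold_locales
    (auto simp: del_edge_def symmetric_def sym_def dest: in_arcsD1 in_arcsD2)

text \<open>Arcs are symmetric, so one-way reachability is already mutual.\<close>

lemma (in pair_graph) scc_of_eq_rtrancl:
  assumes "x \<in> pverts G"
  shows "scc_of x = {y. (x, y) \<in> (parcs G)\<^sup>*}"
proof -
  have "scc_of x = {y. x \<rightarrow>\<^sup>*\<^bsub>with_proj G\<^esub> y}"
    using scc_ofI_reachable' by (auto simp: scc_of_def)
  then show ?thesis using assms by (simp add: reachable_iff_rtrancl)
qed

lemma (in pair_graph) component_verts:
  assumes "H \<in> components G" "x \<in> verts H"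
  shows "x \<in> pverts G" "verts H = {y. (x, y) \<in> (parcs G)\<^sup>*}"
proof -
  have H: "verts H \<in> sccs_verts"
    using assms(1) by (auto simp: components_def sccs_verts_conv)
  then show xV: "x \<in> pverts G" using assms(2) sccs_verts_subsets by auto
  have "scc_of x = verts H"
    using sccs_verts_disjoint[OF H scc_of_in_sccs_verts[OF xV]] in_scc_of_self[OF xV] assms(2)
    by blast
  then show "verts H = {y. (x, y) \<in> (parcs G)\<^sup>*}"
    using scc_of_eq_rtrancl[OF xV] by simp
qed

lemma (in pair_graph) card_components:
  "card (components G) = card ((\<lambda>x. {y. (x, y) \<in> (parcs G)\<^sup>*}) ` pverts G)"
  by (simp add: components_def scc_of_eq_rtrancl sccs_verts_conv_scc_of flip: card_sccs_verts)

text \<open>The sides are the reachability classes of \<open>u\<close> and \<open>v\<close> after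
  deletion. They cover the vertices by connectedness, and they differ because otherwise the number
  of components could not have grown.\<close>

lemma (in pair_graph) bridge_imp_bridged_graph:
  assumes conn: "Digraph_Component.connected (with_proj G)"
    and br: "bridge G u v"
  defines "E \<equiv> parcs (del_edge G u v)"
  shows "bridged_graph G {x. (u, x) \<in> E\<^sup>*} {x. (v, x) \<in> E\<^sup>*} u v"
proof -
  interpret D: pair_graph "del_edge G u v" by (rule pair_graph_del_edge)
  let ?A = "{x. (u, x) \<in> E\<^sup>*}" and ?B = "{x. (v, x) \<in> E\<^sup>*}"
  have E: "E = parcs G - {(u, v), (v, u)}" by (simp add: E_def del_edge_def)
  have uv: "(u, v) \<in> parcs G" using br by (simp add: bridge_def)
  have symG: "sym (parcs G)" using pair_sym_arcs by (simp add: symmetric_def)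
  then have "sym E" by (auto simp: E sym_def)
  then have symE: "(y, x) \<in> E\<^sup>*" if "(x, y) \<in> E\<^sup>*" for x y
    using that by (metis sym_rtrancl symD)
  have connG: "(x, y) \<in> (parcs G)\<^sup>*" if "x \<in> pverts G" "y \<in> pverts G" for x y
    using symmetric_connected_imp_strongly_connected[OF pair_sym_arcs conn] that
      reachable_iff_rtrancl by (auto simp: strongly_connected_def)
  have uV: "u \<in> pverts G" "v \<in> pverts G" using uv in_arcsD1 in_arcsD2 by auto
  have inV: "y \<in> pverts G" if "(x, y) \<in> E\<^sup>*" "x \<in> pverts G" for x y
    using that by (induction rule: rtrancl_induct) (auto simp: E dest: in_arcsD2)
  \<comment> \<open>Along a walk from \<open>u\<close> in \<open>G\<close>, a surviving arc keeps
    the class, and a deleted arc ends in \<open>u\<close> or \<open>v\<close>, hence in one of the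
    two classes.\<close>
  have cover: "y \<in> ?A \<union> ?B" if "y \<in> pverts G" for y
    using connG[OF uV(1) that]
  proof (induction rule: rtrancl_induct)
    case base
    then show ?case by simp
  next
    case (step y z)
    then show ?case
      by (cases "(y, z) \<in> E") (auto simp: E intro: rtrancl_into_rtrancl)
  qed
  have verts: "pverts G = ?A \<union> ?B" using cover inV uV by auto
  have not_uv: "(u, v) \<notin> E\<^sup>*"
  proof
    assume "(u, v) \<in> E\<^sup>*"
    \<comment> \<open>If \<open>v\<close> were still reachable, all vertices would form a single
      class, whereas \<open>G\<close> already has at least one component.\<close>
    then have "(u, y) \<in> E\<^sup>*" if "y \<in> pverts G" for y
      using cover[OF that] by (auto intro: rtrancl_trans)
    then have "{y. (x, y) \<in> E\<^sup>*} = pverts G" if "x \<in> pverts G" for x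
      using that symE inV by (blast intro: rtrancl_trans)
    then have "(\<lambda>x. {y. (x, y) \<in> E\<^sup>*}) ` pverts G \<subseteq> {pverts G}" by auto
    then have "card ((\<lambda>x. {y. (x, y) \<in> E\<^sup>*}) ` pverts G) \<le> 1"
      using card_mono[of "{pverts G}"] by auto
    then have "card (components (del_edge G u v)) \<le> 1"
      using D.card_components by (simp add: E_def) (simp add: del_edge_def)
    moreover have "card (components G) \<ge> 1"
      unfolding card_components using uV pair_finite_verts
      by (simp add: Suc_le_eq card_gt_0_iff) blast
    ultimately show False using br by (simp add: bridge_def)
  qed
  have disj: "?A \<inter> ?B = {}" using not_uv symE by (auto dest: rtrancl_trans)
  have only: "x = u \<and> y = v" if "(x, y) \<in> parcs G" "x \<in> ?A" "y \<in> ?B" for x y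
  proof (cases "(x, y) \<in> E")
    case True
    with that(2) have "y \<in> ?A" by (auto intro: rtrancl_into_rtrancl)
    with that(3) disj show ?thesis by blast
  next
    \<comment> \<open>The arc is a deleted one; were it \<open>(v, u)\<close>, then \<open>v\<close>
      would lie in \<open>?A\<close>.\<close>
    case False
    with that not_uv show ?thesis by (auto simp: E)
  qed
  show ?thesis
    using verts disj uv only connG by unfold_locales auto
qed

lemma card_ge_2_obtains:
  assumes "2 \<le> card S"
  obtains z where "z \<in> S" "z \<noteq> x"
  using assms by (metis One_nat_def card.empty card.insert card_mono empty_iff finite.intros
      insert_absorb insert_iff not_less_eq_eq numeral_2_eq_2 subsetI)

theorem mainTheorem5:
  fixes G :: "'a pair_pre_digraph"
    and H H' :: "('a, 'a \<times> 'a) pre_digraph"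
    and u v u' v' :: 'a
  assumes "pair_graph G"
    and "Digraph_Component.connected (with_proj G)"
    and "bridge G u v"
    and "H \<in> components (del_edge G u v)" and "u \<in> verts H"
    and "H' \<in> components (del_edge G u v)" and "v \<in> verts H'"
    and "card (verts H) \<ge> 2" and "card (verts H') \<ge> 2"
    and "u' \<notin> pverts G - {u, v}"
    and "v' \<notin> pverts (identify G u v u')"
  shows "ecc (sigma G u v u' v') < ecc G"
proof -
  interpret pair_graph G by fact
  interpret D: pair_graph "del_edge G u v" by (rule pair_graph_del_edge)
  obtain z where "z \<in> verts H" "z \<noteq> u" using assms(8) by (rule card_ge_2_obtains)
  moreover obtain w where "w \<in> verts H'" "w \<noteq> v" using assms(9) by (rule card_ge_2_obtains)
  \<comment> \<open>\<open>component_verts\<close> identifies the vertex sets of \<open>H\<close>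
    and \<open>H'\<close> with the two sides.\<close>
  ultimately show ?thesis
    using bridged_graph.ecc_sigma_less[OF bridge_imp_bridged_graph[OF assms(2,3)]]
      D.component_verts(2)[OF assms(4,5)] D.component_verts(2)[OF assms(6,7)] assms(10,11)
    by auto
qed

end
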